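(* Let $0<\sigma<1$, $d\in\{2,3\}$ and $T>0$. The data-to-solution map $u_0\mapsto u$ of the incompressible Euler equations on $\mathbb{T}^d$ is not uniformly continuous from the unit ball of $c^{1,\sigma}(\mathbb{T}^d)$ into $C\left([0,T];c^{1,\sigma}(\mathbb{T}^d,\mathbb{R}^d)\right)$. That is, there is $\varepsilon>0$ such that for every $\eta>0$ there are initial data $u_0,v_0$ in the domain of the data-to-solution map, with $\|u_0\|_{C^{1,\sigma}}\le1$, $\|v_0\|_{C^{1,\sigma}}\le 1$ and $\|u_0-v_0\|_{C^{1,\sigma}}<\eta$, whose corresponding solutions $u,v$ satisfy $\sup_{t\in[0,T]}\|u(t)-v(t)\|_{C^{1,\sigma}}\ge\varepsilon$.
   Context: $\mathbb{T}^d=\mathbb{R}^d/2\pi\mathbb{Z}^d$. The Cauchy problem for the incompressible Euler equations on $\mathbb{T}^d$ is $$\partial_t u+(u\cdot\nabla)u+\nabla \pi=0,\qquad \operatorname{div}u=0,\qquad u(0,x)=u_0(x),$$ where $u(t,x)\in\mathbb{R}^d$ is the velocity, $\pi(t,x)\in\mathbb{R}$ is the pressure (a function on $\mathbb{T}^d$ for each $t$), and $u_0:\mathbb{T}^d\to\mathbb{R}^d$ is a divergence-free initial velocity. $C^{1,\sigma}(\mathbb{T}^d)$ is the usual Hölder space of $C^1$ functions whose first-order derivatives are Hölder continuous of exponent $\sigma$, with its usual norm $\|\cdot\|_{C^{1,\sigma}}$. The little Hölder space $c^{1,\sigma}(\mathbb{T}^d)$ is the closure of $C^\infty(\mathbb{T}^d)$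 in $C^{1,\sigma}(\mathbb{T}^d)$, with the same norm; equivalently, it consists of the $u\in C^{1,\sigma}$ such that $\lim_{h\to0}\sup_{0<|x-y|<h}\frac{|\partial^\alpha u(x)-\partial^\alpha u(y)|}{|x-y|^\sigma}=0$ for all $|\alpha|=1$. Data-to-solution map: its domain consists of the divergence-free $u_0\in c^{1,\sigma}(\mathbb{T}^d,\mathbb{R}^d)$ for which the Euler Cauchy problem has a solution $u\in C([0,T];c^{1,\sigma}(\mathbb{T}^d,\mathbb{R}^d))$ (necessarily unique), and it sends $u_0$ to $u$. *)

theory Defs
  imports "HOL-Analysis.Analysis"
begin

text \<open>Functions on the torus \<open>\<real>\<^sup>d / 2\<pi>\<int>\<^sup>d\<close> are represented by their
  periodic lifts to \<open>\<real>\<^sup>d\<close>.\<close>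

definition torus_periodic :: "(real^'d \<Rightarrow> 'b) \<Rightarrow> bool" where
  "torus_periodic f \<longleftrightarrow> (\<forall>x i. f (x + (2 * pi) *\<^sub>R axis i 1) = f x)"

definition partial :: "'d \<Rightarrow> (real^'d \<Rightarrow> 'b::real_normed_vector) \<Rightarrow> real^'d \<Rightarrow> 'b" where
  "partial i f x = frechet_derivative f (at x) (axis i 1)"

primrec C_k :: "nat \<Rightarrow> (real^'d \<Rightarrow> 'b::real_normed_vector) \<Rightarrow> bool" where
  "C_k 0 f \<longleftrightarrow> continuous_on UNIV f"
| "C_k (Suc k) f \<longleftrightarrow> (\<forall>x. f differentiable (at x)) \<and> (\<forall>i. C_k k (partial i f))"

definition torus_smooth :: "(real^'d \<Rightarrow> 'b::real_normed_vector) set" where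
  "torus_smooth = {f. torus_periodic f \<and> (\<forall>k. C_k k f)}"

definition holder_continuous :: "real \<Rightarrow> (real^'d \<Rightarrow> 'b::real_normed_vector) \<Rightarrow> bool" where
  "holder_continuous \<sigma> g \<longleftrightarrow> (\<exists>C. \<forall>x y. dist (g x) (g y) \<le> C * dist x y powr \<sigma>)"

definition C1_holder :: "real \<Rightarrow> (real^'d \<Rightarrow> 'b::real_normed_vector) set" where
  "C1_holder \<sigma> = {f. torus_periodic f \<and> C_k 1 f \<and> (\<forall>i. holder_continuous \<sigma> (partial i f))}"

text \<open>For a periodic function, taking the supremum over pairs in \<open>\<real>\<^sup>d\<close> gives the same value
  as taking it over pairs of torus points with the quotient distance, since that distance is the
  minimum over all lifts.\<close>

definition holder_seminorm :: "real \<Rightarrow> (real^'d \<Rightarrow> 'b::real_normed_vector) \<Rightarrow> real" where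
  "holder_seminorm \<sigma> g = (SUP (x, y)\<in>{(x, y). x \<noteq> y}. dist (g x) (g y) / dist x y powr \<sigma>)"

text \<open>All suprema below are finite on \<open>C1_holder \<sigma>\<close>; elsewhere the value is meaningless.\<close>

definition C1_holder_norm :: "real \<Rightarrow> (real^'d \<Rightarrow> 'b::real_normed_vector) \<Rightarrow> real" where
  "C1_holder_norm \<sigma> f = (SUP x. norm (f x)) + (\<Sum>i\<in>UNIV. SUP x. norm (partial i f x))
     + (\<Sum>i\<in>UNIV. holder_seminorm \<sigma> (partial i f))"

definition little_holder :: "real \<Rightarrow> (real^'d \<Rightarrow> 'b::real_normed_vector) set" where
  "little_holder \<sigma> = {f \<in> C1_holder \<sigma>.
     \<forall>\<epsilon>>0. \<exists>\<phi>\<in>torus_smooth. C1_holder_norm \<sigma> (\<lambda>x. f x - \<phi> x) < \<epsilon>}"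

definition continuous_curve :: "real \<Rightarrow> real \<Rightarrow> (real \<Rightarrow> real^'d \<Rightarrow> 'b::real_normed_vector) \<Rightarrow> bool" where
  "continuous_curve \<sigma> T u \<longleftrightarrow> (\<forall>t\<in>{0..T}. u t \<in> little_holder \<sigma> \<and>
     ((\<lambda>s. C1_holder_norm \<sigma> (\<lambda>x. u s x - u t x)) \<longlongrightarrow> 0) (at t within {0..T}))"

definition gradient :: "(real^'d \<Rightarrow> real) \<Rightarrow> real^'d \<Rightarrow> real^'d" where
  "gradient q x = (\<chi> i. partial i q x)"

definition divergence :: "(real^'d \<Rightarrow> real^'d) \<Rightarrow> real^'d \<Rightarrow> real" where
  "divergence v x = (\<Sum>i\<in>UNIV. partial i v x $ i)"

definition advection :: "(real^'d \<Rightarrow> real^'d) \<Rightarrow> real^'d \<Rightarrow> real^'d" where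
  "advection v x = (\<Sum>i\<in>UNIV. (v x $ i) *\<^sub>R partial i v x)"

text \<open>The time derivative exists pointwise, one-sided at \<open>0\<close> and \<open>T\<close>. Joint continuity of the pressure
  gradient (equivalently, of the time derivative) makes the solution classical; it holds for every
  distributional solution in \<open>C([0,T]; c\<^sup>1\<^sup>,\<^sup>\<sigma>)\<close>, by elliptic regularity of the pressure.\<close>

definition euler_solution ::
    "real \<Rightarrow> real \<Rightarrow> (real^'d \<Rightarrow> real^'d) \<Rightarrow> (real \<Rightarrow> real^'d \<Rightarrow> real^'d) \<Rightarrow> bool" where
  "euler_solution \<sigma> T u0 u \<longleftrightarrow>
     continuous_curve \<sigma> T u \<and>
     (\<exists>p :: real \<Rightarrow> real^'d \<Rightarrow> real.
        (\<forall>t\<in>{0..T}. torus_periodic (p t) \<and> (\<forall>x. p t differentiable (at x))) \<and>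
        continuous_on ({0..T} \<times> UNIV) (\<lambda>(t, x). gradient (p t) x) \<and>
        (\<forall>t\<in>{0..T}. \<forall>x. ((\<lambda>s. u s x) has_vector_derivative
           (- advection (u t) x - gradient (p t) x)) (at t within {0..T}))) \<and>
     (\<forall>t\<in>{0..T}. \<forall>x. divergence (u t) x = 0) \<and>
     u 0 = u0"

definition euler_domain :: "real \<Rightarrow> real \<Rightarrow> (real^'d \<Rightarrow> real^'d) set" where
  "euler_domain \<sigma> T =
     {u0 \<in> little_holder \<sigma>. (\<forall>x. divergence u0 x = 0) \<and> (\<exists>u. euler_solution \<sigma> T u0 u)}"

text \<open>Solutions are unique on \<open>[0,T]\<close> only; membership in \<open>extensional {0..T}\<close> fixes the
  irrelevant values at other times.\<close>

definition data_to_solution ::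
    "real \<Rightarrow> real \<Rightarrow> (real^'d \<Rightarrow> real^'d) \<Rightarrow> real \<Rightarrow> real^'d \<Rightarrow> real^'d" where
  "data_to_solution \<sigma> T u0 = (THE u. u \<in> extensional {0..T} \<and> euler_solution \<sigma> T u0 u)"

end

theory Submission
  imports Defs
begin

text \<open>
  Nonuniform dependence comes from transport by a slightly different mean velocity. For distinct
  coordinates \<open>i\<close> and \<open>j\<close>, a shear \<open>f(x\<^sub>j) e\<^sub>i\<close> is a steady Euler flow without pressure. Adding
  the constant velocity \<open>c e\<^sub>j\<close> makes the profile drift, by Galilean invariance:
  \<open>u(t,x) = f(x\<^sub>j - c t) e\<^sub>i + c e\<^sub>j\<close> is again a solution with constant pressure. The family of
  profiles is \<open>f(y) = a cos(n y)\<close> with \<open>a = n\<^sup>-\<^sup>1\<^sup>-\<^sup>\<sigma> / 8\<close>, whose \<open>C\<^sup>1\<^sup>,\<^sup>\<sigma>\<close> norm stays between two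
  positive constants as \<open>n\<close> grows. The two flows with drift \<open>0\<close> and drift \<open>c = \<pi> / (n T)\<close>
  start at distance \<open>O(1/n)\<close>, yet at time \<open>T\<close> the second profile has moved by half a
  wavelength. There the two waves have opposite signs and their difference is \<open>2 f\<close> up to a constant,
  whose norm is bounded below independently of \<open>n\<close> (\<open>C1_holder_norm_plane_wave_ge\<close>).

  The data-to-solution map is a definite description, so it can be evaluated on these data only
  once solutions are known to be unique (\<open>euler_solution_unique\<close>). Uniqueness is the classical
  energy argument: for two solutions \<open>u, v\<close> with the same data the difference \<open>w\<close> satisfies
  \<open>d/dt \<integral>|w|\<^sup>2 = - 2 \<integral> w \<cdot> (w \<cdot> \<nabla>) v\<close>, because both the pressure term and the term
  \<open>w \<cdot> (u \<cdot> \<nabla>) w = u \<cdot> \<nabla>|w|\<^sup>2 / 2\<close> are integrals of a divergence-free field against a gradient and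
  vanish (\<open>energy_identity\<close>). Since \<open>\<nabla>v\<close> is bounded on the compact set \<open>[0,T] \<times> \<T>\<^sup>d\<close>, Gronwall's
  inequality gives \<open>w = 0\<close>. All integrations by parts
  rest on the fact that the integral of a partial derivative of a periodic function over a period cell
  vanishes (\<open>integral_cell_partial_eq_0\<close>).
\<close>

section \<open>Partial derivatives\<close>

lemma continuous_on_if_differentiable:
  "(\<And>x. f differentiable (at x)) \<Longrightarrow> continuous_on S f"
  by (simp add: continuous_at_imp_continuous_on differentiable_imp_continuous_within)

lemma partial_eqI: "(f has_derivative f') (at x) \<Longrightarrow> partial i f x = f' (axis i 1)"
  unfolding partial_def using frechet_derivative_at by metis

lemma differentiable_has_partial:
  assumes "f differentiable (at x)"
  shows "((\<lambda>h. f (x + h *\<^sub>R axis i 1)) has_vector_derivative partial i f (x)) (at 0 within S)"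
proof -
  have f: "(f has_derivative frechet_derivative f (at x)) (at (x + 0 *\<^sub>R axis i 1))"
    using assms by (simp flip: frechet_derivative_works)
  have l: "linear (frechet_derivative f (at x))"
    using assms linear_frechet_derivative by blast
  have "((\<lambda>h. x + h *\<^sub>R axis i (1::real)) has_derivative (\<lambda>h. h *\<^sub>R axis i 1)) (at 0 within S)"
    by (auto intro!: derivative_eq_intros)
  from has_derivative_compose[OF this f] show ?thesis
    by (simp add: has_vector_derivative_def partial_def linear_scale[OF l])
qed

lemma partial_diff:
  assumes "f differentiable (at x)" "g differentiable (at x)"
  shows "partial i (\<lambda>x. f x - g x) x = partial i f x - partial i g x"
  using assms unfolding frechet_derivative_works partial_def
  by (metis frechet_derivative_at has_derivative_diff)

lemma partial_inner:
  assumes "f differentiable (at x)" "g differentiable (at x)"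
  shows "partial i (\<lambda>x. f x \<bullet> g x) x = partial i f x \<bullet> g x + f x \<bullet> partial i g x"
proof -
  have "((\<lambda>x. f x \<bullet> g x) has_derivative
      (\<lambda>h. f x \<bullet> frechet_derivative g (at x) h + frechet_derivative f (at x) h \<bullet> g x)) (at x)"
    using assms unfolding frechet_derivative_works by (rule has_derivative_inner)
  from partial_eqI[OF this] show ?thesis by (simp add: partial_def)
qed

lemma partial_mult:
  fixes f g :: "real^'d \<Rightarrow> real"
  assumes "f differentiable (at x)" "g differentiable (at x)"
  shows "partial i (\<lambda>x. f x * g x) x = partial i f x * g x + f x * partial i g x"
  using partial_inner[OF assms, of i] by simp

lemma partial_nth:
  fixes f :: "real^'d \<Rightarrow> real^'d"
  assumes "f differentiable (at x)"
  shows "partial i (\<lambda>x. f x $ k) x = partial i f x $ k"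
proof -
  have "((\<lambda>x. f x $ k) has_derivative (\<lambda>h. frechet_derivative f (at x) h $ k)) (at x)"
    using assms unfolding frechet_derivative_works
    by (rule bounded_linear.has_derivative[OF bounded_linear_vec_nth])
  from partial_eqI[OF this] show ?thesis by (simp add: partial_def)
qed

lemma differentiable_nth:
  fixes f :: "'a::real_normed_vector \<Rightarrow> real^'d"
  assumes "f differentiable F"
  shows "(\<lambda>x. f x $ k) differentiable F"
  using assms bounded_linear.has_derivative[OF bounded_linear_vec_nth] unfolding differentiable_def by blast

text \<open>A period \<open>v\<close> of \<open>f\<close> carries difference quotients at \<open>x\<close> to those at \<open>x + v\<close>. The argument compares
  the sets of all derivatives at the two points, because \<open>partial\<close> is defined by a choice from such a set.\<close>

lemma partial_periodic:
  assumes "torus_periodic f"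
  shows "torus_periodic (partial i f)"
proof -
  have shift: "(f has_derivative D) (at x)"
    if v: "\<And>x. f (x + v) = f x" and D: "(f has_derivative D) (at (x + v))" for x v D
  proof -
    have "((\<lambda>x. x + v) has_derivative (\<lambda>h. h)) (at x)"
      by (auto intro!: derivative_eq_intros)
    from has_derivative_compose[OF this D] show ?thesis by (simp add: v)
  qed
  have "frechet_derivative f (at (x + v)) = frechet_derivative f (at x)"
    if v: "\<And>x. f (x + v) = f x" for x v
  proof -
    have "f (x + - v) = f x" for x
      using v[of "x + - v"] by simp
    then have "(f has_derivative D) (at (x + v)) \<longleftrightarrow> (f has_derivative D) (at x)" for D
      using shift[of v D x, OF v] shift[of "- v" D "x + v"] by auto
    then show ?thesis unfolding frechet_derivative_def by simp
  qed
  then show ?thesis using assms unfolding torus_periodic_def partial_def by metis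
qed

section \<open>Integration over a period cell\<close>

definition torus_cell :: "(real^'d) set" where
  "torus_cell = cbox 0 (\<chi> i. 2 * pi)"

lemma periodic_int_multiple:
  assumes "torus_periodic f"
  shows "f (x + (2 * pi * of_int k) *\<^sub>R axis i 1) = f x"
proof -
  have p: "f (x + (2 * pi) *\<^sub>R axis i 1) = f x" for x
    using assms by (simp add: torus_periodic_def)
  have nat: "f (x + (2 * pi * of_nat n) *\<^sub>R axis i 1) = f x" for n x
  proof (induction n)
    case (Suc n)
    have "x + (2 * pi * of_nat (Suc n)) *\<^sub>R axis i 1
        = (x + (2 * pi * of_nat n) *\<^sub>R axis i 1) + (2 * pi) *\<^sub>R axis i 1"
      by (simp add: algebra_simps)
    then show ?case using p Suc by metis
  qed simp
  show ?thesis
  proof (cases k)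
    case (neg n)
    have "f (x + (2 * pi * of_int k) *\<^sub>R axis i 1)
       = f (x + (2 * pi * of_int k) *\<^sub>R axis i 1 + (2 * pi * of_nat (Suc n)) *\<^sub>R axis i 1)"
      by (rule nat[symmetric])
    also have "x + (2 * pi * of_int k) *\<^sub>R axis i 1 + (2 * pi * of_nat (Suc n)) *\<^sub>R axis i 1 = x"
      by (simp add: neg add.assoc distrib_left[symmetric] flip: scaleR_add_left)
    finally show ?thesis .
  qed (simp add: nat)
qed

lemma periodic_represented_in_cell:
  fixes f :: "real^'d \<Rightarrow> 'b"
  assumes f: "torus_periodic f"
  obtains y where "y \<in> torus_cell" "f x = f y"
proof -
  define k where "k i = - \<lfloor>x $ i / (2 * pi)\<rfloor>" for i
  define y where "y = x + (\<Sum>i\<in>UNIV. (2 * pi * of_int (k i)) *\<^sub>R axis i 1)"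
  have yi: "y $ i = x $ i + 2 * pi * of_int (k i)" for i
    by (simp add: y_def axis_def if_distrib[of "\<lambda>u. _ * u"] cong: if_cong)
  have "0 \<le> y $ i \<and> y $ i \<le> 2 * pi" for i
  proof -
    have "x $ i = (x $ i / (2 * pi)) * (2 * pi)" by simp
    then have "y $ i = 2 * pi * frac (x $ i / (2 * pi))"
      by (simp add: yi k_def frac_def algebra_simps)
    then show ?thesis
      using frac_lt_1[of "x $ i / (2 * pi)"] frac_ge_0[of "x $ i / (2 * pi)"] by simp
  qed
  then have "y \<in> torus_cell" by (simp add: torus_cell_def mem_box_cart)
  moreover have "f x = f y"
  proof -
    have "f (x + (\<Sum>i\<in>S. (2 * pi * of_int (k i)) *\<^sub>R axis i 1)) = f x" if "finite S" for S
      using that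
    proof (induction S)
      case (insert i S)
      then show ?case
        using periodic_int_multiple[OF f, of "x + (\<Sum>i\<in>S. (2 * pi * of_int (k i)) *\<^sub>R axis i 1)" "k i" i]
        by (simp add: algebra_simps)
    qed simp
    then show ?thesis by (simp add: y_def)
  qed
  ultimately show ?thesis using that by blast
qed

lemma periodic_continuous_bounded:
  fixes f :: "real^'d \<Rightarrow> 'b::real_normed_vector"
  assumes "torus_periodic f" "continuous_on UNIV f"
  shows "bdd_above (range (\<lambda>x. norm (f x)))"
proof -
  have "compact (f ` torus_cell)"
    unfolding torus_cell_def
    by (intro compact_continuous_image compact_cbox continuous_on_subset[OF assms(2)]) auto
  then obtain B where B: "\<And>y. y \<in> torus_cell \<Longrightarrow> norm (f y) \<le> B"
    by (meson compact_imp_bounded bounded_iff imageI)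
  show ?thesis
  proof (rule bdd_aboveI2)
    fix x
    obtain y where "y \<in> torus_cell" "f x = f y"
      using periodic_represented_in_cell[OF assms(1)] by blast
    then show "norm (f x) \<le> B" using B by simp
  qed
qed

text \<open>The translated cell splits along the hyperplane \<open>x\<^sub>i = 2\<pi>\<close>. The part beyond it is moved back by one
  period and fills exactly the slab that the translation left uncovered.\<close>

lemma integral_cell_translate:
  fixes f :: "real^'d \<Rightarrow> real"
  assumes per: "torus_periodic f" and cont: "continuous_on UNIV f"
    and h: "0 \<le> h" "h \<le> 2 * pi"
  shows "integral torus_cell (\<lambda>x. f (x + h *\<^sub>R axis i 1)) = integral torus_cell f"
proof -
  let ?e = "axis i 1 :: real^'d"
  let ?L = "(\<chi> i. 2 * pi) :: real^'d"
  have e: "?e \<in> Basis" by (simp add: axis_in_Basis_iff)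
  have int: "f integrable_on cbox a b" for a b
    by (intro integrable_continuous continuous_on_subset[OF cont]) auto
  have split: "integral (cbox a b) f =
      integral (cbox a b \<inter> {x. x \<bullet> ?e \<le> c}) f + integral (cbox a b \<inter> {x. x \<bullet> ?e \<ge> c}) f" for a b c
    by (rule integral_split) (use int e in auto)
  define A where "A = cbox 0 (\<chi> k. if k = i then h else 2 * pi)"
  define B where "B = cbox (h *\<^sub>R ?e) ?L"
  define C where "C = cbox ((2 * pi) *\<^sub>R ?e) (?L + h *\<^sub>R ?e)"
  \<comment> \<open>Separating the \<open>i\<close>-th coordinate reduces the splitting of boxes to linear arithmetic in it.\<close>
  have mem: "x \<in> cbox a b \<longleftrightarrow> (a $ i \<le> x $ i \<and> x $ i \<le> b $ i) \<and>
      (\<forall>k. k \<noteq> i \<longrightarrow> a $ k \<le> x $ k \<and> x $ k \<le> b $ k)" for a b x :: "real^'d"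
    unfolding mem_box_cart by metis
  have 1: "cbox 0 ?L \<inter> {x. x \<bullet> ?e \<le> h} = A" "cbox 0 ?L \<inter> {x. x \<bullet> ?e \<ge> h} = B"
    and 2: "cbox (h *\<^sub>R ?e) (?L + h *\<^sub>R ?e) \<inter> {x. x \<bullet> ?e \<le> 2 * pi} = B"
      "cbox (h *\<^sub>R ?e) (?L + h *\<^sub>R ?e) \<inter> {x. x \<bullet> ?e \<ge> 2 * pi} = C"
    unfolding A_def B_def C_def set_eq_iff Int_iff mem_Collect_eq mem
    using h by (auto simp: inner_axis) (auto simp: axis_def)
  have "integral torus_cell (\<lambda>x. f (x + h *\<^sub>R ?e)) = integral (cbox (h *\<^sub>R ?e) (?L + h *\<^sub>R ?e)) f"
    unfolding torus_cell_def
    using integral_shift_cbox[where a = "h *\<^sub>R ?e" and b = "?L + h *\<^sub>R ?e" and c = "h *\<^sub>R ?e" and f = f] by simp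
  also have "\<dots> = integral B f + integral C f"
    using split[of "h *\<^sub>R ?e" "?L + h *\<^sub>R ?e" "2 * pi"] by (simp add: 2)
  also have "integral C f = integral A (\<lambda>x. f (x + (2 * pi) *\<^sub>R ?e))"
  proof -
    have "?L + h *\<^sub>R ?e = (\<chi> k. if k = i then h else 2 * pi) + (2 * pi) *\<^sub>R ?e"
      by (simp add: vec_eq_iff axis_def)
    then show ?thesis unfolding A_def C_def
      using integral_shift_cbox[where a = "(2 * pi) *\<^sub>R ?e" and c = "(2 * pi) *\<^sub>R ?e" and f = f
          and b = "(\<chi> k. if k = i then h else 2 * pi) + (2 * pi) *\<^sub>R ?e"] by simp
  qed
  also have "\<dots> = integral A f"
    using per by (simp add: torus_periodic_def)
  also have "integral B f + integral A f = integral torus_cell f"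
    using split[of 0 ?L h] by (simp add: 1 torus_cell_def)
  finally show ?thesis .
qed

text \<open>The integral of a translate of \<open>f\<close> does not depend on the translation, so its derivative with respect
  to the translation is zero; differentiation under the integral sign identifies that
  derivative.\<close>

lemma integral_cell_partial_eq_0:
  fixes f :: "real^'d \<Rightarrow> real"
  assumes per: "torus_periodic f" and diff: "\<And>x. f differentiable (at x)"
    and cont: "continuous_on UNIV (partial i f)"
  shows "integral torus_cell (partial i f) = 0"
proof -
  let ?e = "axis i 1 :: real^'d"
  have contf: "continuous_on UNIV f"
    using diff by (rule continuous_on_if_differentiable)
  have 1: "((\<lambda>h. integral torus_cell (\<lambda>x. f (x + h *\<^sub>R ?e))) has_vector_derivative
      integral torus_cell (\<lambda>x. partial i f (x + 0 *\<^sub>R ?e))) (at 0 within {0..2*pi})"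
    unfolding torus_cell_def
  proof (rule leibniz_rule_vector_derivative[where fx = "\<lambda>h x. partial i f (x + h *\<^sub>R ?e)"])
    fix h x
    have "((\<lambda>s. f ((x + h *\<^sub>R ?e) + s *\<^sub>R ?e)) has_vector_derivative partial i f (x + h *\<^sub>R ?e))
        (at (h + (-h)) within (\<lambda>s. s + (-h)) ` {0..2 * pi})"
      using differentiable_has_partial[OF diff] by simp
    then have "((\<lambda>s. f ((x + h *\<^sub>R ?e) + s *\<^sub>R ?e)) \<circ> (\<lambda>s. s + (-h)) has_vector_derivative
        1 *\<^sub>R partial i f (x + h *\<^sub>R ?e)) (at h within {0..2 * pi})"
      by (intro vector_diff_chain_within) (auto intro!: derivative_eq_intros)
    then show "((\<lambda>h. f (x + h *\<^sub>R ?e)) has_vector_derivative partial i f (x + h *\<^sub>R ?e))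
        (at h within {0..2 * pi})"
      by (simp add: o_def algebra_simps)
  next
    show "(\<lambda>x. f (x + h *\<^sub>R ?e)) integrable_on cbox 0 (\<chi> i. 2 * pi)" for h
      by (intro integrable_continuous continuous_on_compose2[OF contf] continuous_intros) auto
    show "continuous_on ({0..2 * pi} \<times> cbox 0 (\<chi> i. 2 * pi)) (\<lambda>(h, x). partial i f (x + h *\<^sub>R ?e))"
      unfolding split_def
      by (intro continuous_on_compose2[OF cont] continuous_intros) auto
  qed auto
  have 2: "((\<lambda>h. integral torus_cell (\<lambda>x. f (x + h *\<^sub>R ?e))) has_vector_derivative 0) (at 0 within {0..2*pi})"
  proof (rule has_vector_derivative_transform)
    show "((\<lambda>h::real. integral torus_cell f) has_vector_derivative 0) (at 0 within {0..2*pi})"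
      by (rule has_vector_derivative_const)
  qed (auto simp: integral_cell_translate[OF per contf])
  show ?thesis
    using vector_derivative_unique_within_closed_interval[of 0 "2*pi" 0, unfolded cbox_interval, OF _ _ 1 2] by simp
qed

section \<open>The Hoelder norm and curves continuous in it\<close>

lemma C1_holderD:
  assumes "f \<in> C1_holder \<sigma>"
  shows "torus_periodic f" "f differentiable (at x)" "continuous_on UNIV (partial i f)"
    "holder_continuous \<sigma> (partial i f)"
  using assms by (auto simp: C1_holder_def)

lemma C1_holder_diff:
  assumes "f \<in> C1_holder \<sigma>" "g \<in> C1_holder \<sigma>"
  shows "(\<lambda>x. f x - g x) \<in> C1_holder \<sigma>"
proof -
  note f = C1_holderD[OF assms(1)] and g = C1_holderD[OF assms(2)]
  have eq: "partial i (\<lambda>x. f x - g x) = (\<lambda>x. partial i f x - partial i g x)" for i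
    using partial_diff f(2) g(2) by blast
  have "holder_continuous \<sigma> (\<lambda>x. partial i f x - partial i g x)" for i
  proof -
    obtain C D where "\<And>x y. dist (partial i f x) (partial i f y) \<le> C * dist x y powr \<sigma>"
      "\<And>x y. dist (partial i g x) (partial i g y) \<le> D * dist x y powr \<sigma>"
      using f(4)[of i] g(4)[of i] unfolding holder_continuous_def by auto
    then have "dist (partial i f x - partial i g x) (partial i f y - partial i g y)
        \<le> (C + D) * dist x y powr \<sigma>" for x y
      using dist_triangle_add[of "partial i f x" "- partial i g x" "partial i f y" "- partial i g y"]
      by (smt (verit) add_uminus_conv_diff dist_minus distrib_right)
    then show ?thesis unfolding holder_continuous_def by blast
  qed
  then show ?thesis
    using f g by (auto simp: C1_holder_def eq torus_periodic_def intro: continuous_on_diff)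
qed

lemma holder_quotient_le_seminorm:
  assumes "holder_continuous \<sigma> g" "x \<noteq> y"
  shows "dist (g x) (g y) / dist x y powr \<sigma> \<le> holder_seminorm \<sigma> g"
proof -
  obtain C where C: "\<And>x y. dist (g x) (g y) \<le> C * dist x y powr \<sigma>"
    using assms unfolding holder_continuous_def by blast
  have "dist (g x) (g y) / dist x y powr \<sigma> \<le> C" if "x \<noteq> y" for x y
    using C[of x y] that by (simp add: divide_le_eq)
  then have "bdd_above ((\<lambda>(x, y). dist (g x) (g y) / dist x y powr \<sigma>) ` {(x, y). x \<noteq> y})"
    by (intro bdd_aboveI2[where M = C]) auto
  from cSUP_upper[OF _ this, of "(x, y)"] assms(2) show ?thesis
    unfolding holder_seminorm_def by simp
qed

lemma ex_distinct_points: "\<exists>x y :: real^'d. x \<noteq> y"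
  by (metis axis_eq_0_iff zero_neq_one)

lemma holder_seminorm_nonneg:
  fixes g :: "real^'d \<Rightarrow> 'b::real_normed_vector"
  assumes "holder_continuous \<sigma> g"
  shows "0 \<le> holder_seminorm \<sigma> g"
proof -
  obtain x y :: "real^'d" where "x \<noteq> y" using ex_distinct_points by blast
  have "0 \<le> dist (g x) (g y) / dist x y powr \<sigma>" by simp
  also have "\<dots> \<le> holder_seminorm \<sigma> g" by (rule holder_quotient_le_seminorm[OF assms \<open>x \<noteq> y\<close>])
  finally show ?thesis .
qed

text \<open>A real supremum says something only when it is over a bounded set. For members of \<open>C1_holder \<sigma>\<close> each
  supremum in the norm is bounded, hence each summand is nonnegative and at most the whole norm.\<close>

lemma C1_holder_norm_bounds:
  assumes f: "f \<in> C1_holder \<sigma>"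
  shows norm_le_C1_holder_norm: "norm (f x) \<le> C1_holder_norm \<sigma> f"
    and norm_partial_le_C1_holder_norm: "norm (partial i f x) \<le> C1_holder_norm \<sigma> f"
    and holder_seminorm_le_C1_holder_norm: "holder_seminorm \<sigma> (partial i f) \<le> C1_holder_norm \<sigma> f"
    and C1_holder_norm_nonneg: "0 \<le> C1_holder_norm \<sigma> f"
proof -
  note D = C1_holderD[OF f]
  have 0: "norm (f x) \<le> (SUP x. norm (f x))" for x
    by (intro cSUP_upper periodic_continuous_bounded continuous_on_if_differentiable D) auto
  have 1: "norm (partial i f x) \<le> (SUP x. norm (partial i f x))" for i x
    by (intro cSUP_upper periodic_continuous_bounded partial_periodic D) auto
  have z0: "0 \<le> (SUP x. norm (f x))" using 0[of 0] norm_ge_zero[of "f 0"] by linarith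
  have z1: "0 \<le> (SUP x. norm (partial i f x))" for i
    using 1[of i 0] norm_ge_zero[of "partial i f 0"] by linarith
  have 2: "0 \<le> holder_seminorm \<sigma> (partial i f)" for i
    by (rule holder_seminorm_nonneg[OF D(4)])
  have 3: "(SUP x. norm (partial i f x)) \<le> (\<Sum>i\<in>UNIV. SUP x. norm (partial i f x))" for i
    by (rule member_le_sum) (auto intro: z1)
  have 4: "holder_seminorm \<sigma> (partial i f) \<le> (\<Sum>i\<in>UNIV. holder_seminorm \<sigma> (partial i f))" for i
    by (rule member_le_sum) (auto intro: 2)
  have 5: "0 \<le> (\<Sum>i\<in>UNIV. SUP x. norm (partial i f x))" by (intro sum_nonneg z1)
  have 6: "0 \<le> (\<Sum>i\<in>UNIV. holder_seminorm \<sigma> (partial i f))" by (intro sum_nonneg 2)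
  note dfs = C1_holder_norm_def[of \<sigma> f]
  show "norm (f x) \<le> C1_holder_norm \<sigma> f" using 0[of x] 5 6 dfs by linarith
  show "norm (partial i f x) \<le> C1_holder_norm \<sigma> f" using 1[of i x] 3[of i] z0 6 dfs by linarith
  show "holder_seminorm \<sigma> (partial i f) \<le> C1_holder_norm \<sigma> f" using 4[of i] z0 5 dfs by linarith
  show "0 \<le> C1_holder_norm \<sigma> f" using z0 5 6 dfs by linarith
qed

lemma C1_holder_norm_le:
  fixes f :: "real^'d \<Rightarrow> 'b::real_normed_vector"
  assumes "\<And>x. norm (f x) \<le> a" "\<And>i x. norm (partial i f x) \<le> b i"
    and "\<And>i x y. dist (partial i f x) (partial i f y) \<le> c i * dist x y powr \<sigma>"
  shows "C1_holder_norm \<sigma> f \<le> a + (\<Sum>i\<in>UNIV. b i) + (\<Sum>i\<in>UNIV. c i)"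
  unfolding C1_holder_norm_def holder_seminorm_def
proof (intro add_mono sum_mono cSUP_least)
  show "{(x, y). x \<noteq> (y :: real^'d)} \<noteq> {}" using ex_distinct_points by blast
qed (use assms in \<open>auto simp: divide_le_eq\<close>)

text \<open>Continuity in time that is uniform in space, together with continuity in space at each time,
  gives joint continuity. This turns a curve in the Hoelder space into a function of space-time.\<close>

lemma jointly_continuous:
  fixes g :: "real \<Rightarrow> 'a::metric_space \<Rightarrow> 'b::metric_space"
  assumes cont: "\<And>t. t \<in> I \<Longrightarrow> continuous_on UNIV (g t)"
    and bound: "\<And>s t x. s \<in> I \<Longrightarrow> t \<in> I \<Longrightarrow> dist (g s x) (g t x) \<le> N s t"
    and lim: "\<And>t. t \<in> I \<Longrightarrow> ((\<lambda>s. N s t) \<longlongrightarrow> 0) (at t within I)"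
  shows "continuous_on (I \<times> UNIV) (\<lambda>(t, x). g t x)"
  unfolding continuous_on_iff
proof (intro ballI allI impI)
  fix p :: "real \<times> 'a" and e :: real assume p: "p \<in> I \<times> UNIV" and e: "e > 0"
  obtain t and x :: 'a where px: "p = (t, x)" and t: "t \<in> I" using p by auto
  from lim[OF t] e have "\<forall>\<^sub>F s in at t within I. N s t < e / 2"
    by (auto dest!: order_tendstoD(2)[where a = "e / 2"])
  then obtain d1 where d1: "d1 > 0" "\<And>s. s \<in> I \<Longrightarrow> s \<noteq> t \<Longrightarrow> dist s t < d1 \<Longrightarrow> N s t < e / 2"
    unfolding eventually_at by auto
  obtain d2 where d2: "d2 > 0" "\<And>y. dist y x < d2 \<Longrightarrow> dist (g t y) (g t x) < e / 2"
    using cont[OF t] e unfolding continuous_on_iff by (metis UNIV_I half_gt_zero)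
  have "dist (g s y) (g t x) < e" if s: "s \<in> I" "dist (s, y) (t, x) < min d1 d2" for s y
  proof -
    have "dist s t < d1" "dist y x < d2"
      using s(2) dist_fst_le[of "(s, y)" "(t, x)"] dist_snd_le[of "(s, y)" "(t, x)"] by auto
    then have "dist (g s y) (g t y) < e / 2"
      using d1(2)[of s] bound[OF s(1) t, of y] s(1) e by (cases "s = t") auto
    with d2(2)[OF \<open>dist y x < d2\<close>] show ?thesis
      using dist_triangle[of "g s y" "g t x" "g t y"] by simp
  qed
  then show "\<exists>d>0. \<forall>p'\<in>I \<times> UNIV. dist p' p < d \<longrightarrow>
      dist (case p' of (t, x) \<Rightarrow> g t x) (case p of (t, x) \<Rightarrow> g t x) < e"
    using d1(1) d2(1) px by (intro exI[of _ "min d1 d2"]) auto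
qed

lemma continuous_curve_C1_holder:
  assumes "continuous_curve \<sigma> T u" "t \<in> {0..T}"
  shows "u t \<in> C1_holder \<sigma>"
  using assms by (auto simp: continuous_curve_def little_holder_def)

lemma continuous_curve_jointly_continuous:
  assumes u: "continuous_curve \<sigma> T u"
  shows "continuous_on ({0..T} \<times> UNIV) (\<lambda>(t, x). u t x)"
    and "continuous_on ({0..T} \<times> UNIV) (\<lambda>(t, x). partial i (u t) x)"
proof -
  let ?N = "\<lambda>s t. C1_holder_norm \<sigma> (\<lambda>x. u s x - u t x)"
  note C = continuous_curve_C1_holder[OF u]
  have lim: "((\<lambda>s. ?N s t) \<longlongrightarrow> 0) (at t within {0..T})" if "t \<in> {0..T}" for t
    using u that by (simp add: continuous_curve_def)
  show "continuous_on ({0..T} \<times> UNIV) (\<lambda>(t, x). u t x)"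
    by (rule jointly_continuous[where N = ?N])
       (auto simp: dist_norm intro!: continuous_on_if_differentiable C1_holderD(2) lim C
          norm_le_C1_holder_norm[OF C1_holder_diff[OF C C]])
  show "continuous_on ({0..T} \<times> UNIV) (\<lambda>(t, x). partial i (u t) x)"
  proof (rule jointly_continuous[where N = ?N])
    fix s t x assume st: "s \<in> {0..T}" "t \<in> {0..T}"
    have "dist (partial i (u s) x) (partial i (u t) x) = norm (partial i (\<lambda>x. u s x - u t x) x)"
      using C1_holderD(2) C st by (subst partial_diff) (auto simp: dist_norm)
    also have "\<dots> \<le> ?N s t"
      by (rule norm_partial_le_C1_holder_norm[OF C1_holder_diff[OF C[OF st(1)] C[OF st(2)]]])
    finally show "dist (partial i (u s) x) (partial i (u t) x) \<le> ?N s t" .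
  qed (use C1_holderD(3) C lim in auto)
qed

section \<open>Uniqueness of solutions by the energy method\<close>

text \<open>The derivative bound says that \<open>E t * exp (- K * t)\<close> is nonincreasing. It starts at zero.\<close>

lemma gronwall_zero:
  fixes E :: "real \<Rightarrow> real"
  assumes der: "\<And>t. t \<in> {0..T} \<Longrightarrow> (E has_real_derivative E' t) (at t within {0..T})"
    and le: "\<And>t. t \<in> {0..T} \<Longrightarrow> E' t \<le> K * E t"
    and init: "E 0 = 0" and nonneg: "E t \<ge> 0" and t: "t \<in> {0..T}"
  shows "E t = 0"
proof -
  let ?F = "\<lambda>s. E s * exp (- K * s)"
  have F: "(?F has_real_derivative (E' s - K * E s) * exp (- K * s)) (at s within {0..T})"
    if "s \<in> {0..T}" for s
    by (rule derivative_eq_intros der[OF that] refl)+ (simp add: algebra_simps)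
  have "?F 0 \<ge> ?F t"
  proof (rule DERIV_nonpos_imp_decreasing_open[of 0 t ?F])
    show "continuous_on {0..t} ?F"
      by (rule continuous_on_subset[OF DERIV_continuous_on[OF F]]) (use t in auto)
    fix s assume s: "0 < s" "s < t"
    with t have "at s within {0..T} = at s" by (intro at_within_Icc_at) auto
    moreover have "(E' s - K * E s) * exp (- K * s) \<le> 0"
      using le[of s] s t by (intro mult_nonpos_nonneg) auto
    ultimately show "\<exists>y. (?F has_real_derivative y) (at s) \<and> y \<le> 0"
      using F[of s] s t by auto
  qed (use t in auto)
  then have "E t \<le> 0" by (simp add: init mult_le_0_iff)
  with nonneg show ?thesis by simp
qed

text \<open>The integrand is the divergence of \<open>q a\<close>, since \<open>div a = 0\<close>. This is the Helmholtz
  orthogonality that eliminates the pressure.\<close>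

lemma integral_divergence_free_gradient:
  fixes a :: "real^'d \<Rightarrow> real^'d" and q :: "real^'d \<Rightarrow> real"
  assumes a: "torus_periodic a" "\<And>x. a differentiable (at x)" "\<And>i. continuous_on UNIV (partial i a)"
    and div: "\<And>x. divergence a x = 0"
    and q: "torus_periodic q" "\<And>x. q differentiable (at x)" "\<And>i. continuous_on UNIV (partial i q)"
  shows "integral torus_cell (\<lambda>x. a x \<bullet> gradient q x) = 0"
proof -
  have ca: "continuous_on UNIV a" and cq: "continuous_on UNIV q"
    using a q by (auto intro: continuous_on_if_differentiable)
  have p: "partial i (\<lambda>x. a x $ i * q x) x = partial i a x $ i * q x + a x $ i * partial i q x" for i x
    by (simp add: partial_mult[OF differentiable_nth[OF a(2)] q(2)] partial_nth a(2))
  have c: "continuous_on UNIV (\<lambda>x. partial i (\<lambda>x. a x $ i * q x) x)" for i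
    unfolding p by (intro continuous_intros ca cq a q)
  have "a x \<bullet> gradient q x = (\<Sum>i\<in>UNIV. partial i (\<lambda>x. a x $ i * q x) x)" for x
    using div[of x]
    by (simp add: p sum.distrib flip: sum_distrib_right)
       (simp add: divergence_def gradient_def inner_vec_def)
  then have "integral torus_cell (\<lambda>x. a x \<bullet> gradient q x) =
      integral torus_cell (\<lambda>x. \<Sum>i\<in>UNIV. partial i (\<lambda>x. a x $ i * q x) x)"
    by simp
  also have "\<dots> = (\<Sum>i\<in>UNIV. integral torus_cell (partial i (\<lambda>x. a x $ i * q x)))"
    unfolding torus_cell_def
    by (intro integral_sum integrable_continuous continuous_on_subset[OF c]) auto
  also have "\<dots> = 0"
  proof (intro sum.neutral ballI integral_cell_partial_eq_0)
    fix i
    show "torus_periodic (\<lambda>x. a x $ i * q x)" using a(1) q(1) by (simp add: torus_periodic_def)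
    show "(\<lambda>x. a x $ i * q x) differentiable at x" for x
      by (intro differentiable_mult differentiable_nth a q)
    show "continuous_on UNIV (partial i (\<lambda>x. a x $ i * q x))" using c .
  qed
  finally show ?thesis .
qed

text \<open>With \<open>w = u - v\<close>, the nonlinearity splits as \<open>(u \<cdot> \<nabla>) u - (v \<cdot> \<nabla>) v = (u \<cdot> \<nabla>) w + (w \<cdot> \<nabla>) v\<close>.
  The first summand, tested against \<open>w\<close>, is \<open>u \<cdot> \<nabla>|w|\<^sup>2 / 2\<close>. This and the pressure term
  are a divergence-free field tested against a gradient, so only the stretching term remains.\<close>

lemma energy_identity:
  fixes u v :: "real^'d \<Rightarrow> real^'d" and q :: "real^'d \<Rightarrow> real"
  assumes u: "u \<in> C1_holder \<sigma>" "\<And>x. divergence u x = 0"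
    and v: "v \<in> C1_holder \<sigma>" "\<And>x. divergence v x = 0"
    and q: "torus_periodic q" "\<And>x. q differentiable (at x)" "\<And>i. continuous_on UNIV (partial i q)"
  defines "w \<equiv> \<lambda>x. u x - v x"
  shows "integral torus_cell (\<lambda>x. w x \<bullet> (advection u x - advection v x + gradient q x)) =
    integral torus_cell (\<lambda>x. w x \<bullet> (\<Sum>i\<in>UNIV. (w x $ i) *\<^sub>R partial i v x))"
proof -
  note U = C1_holderD[OF u(1)] and V = C1_holderD[OF v(1)]
  have w: "w \<in> C1_holder \<sigma>" unfolding w_def by (rule C1_holder_diff[OF u(1) v(1)])
  note W = C1_holderD[OF w]
  have pw: "partial i w x = partial i u x - partial i v x" for i x
    unfolding w_def by (rule partial_diff[OF U(2) V(2)])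
  have divw: "divergence w x = 0" for x
    using u(2)[of x] v(2)[of x] by (simp add: divergence_def pw sum_subtractf)
  have cu: "continuous_on UNIV u" and cv: "continuous_on UNIV v" and cw: "continuous_on UNIV w"
    and cq: "continuous_on UNIV q"
    using U(2) V(2) W(2) q(2) by (auto intro: continuous_on_if_differentiable)
  define e where "e = (\<lambda>x. w x \<bullet> w x)"
  have pe: "partial i e x = 2 * (w x \<bullet> partial i w x)" for i x
    unfolding e_def by (simp add: partial_inner[OF W(2) W(2)] inner_commute)
  have e: "torus_periodic e" "e differentiable (at x)" "continuous_on UNIV (partial i e)" for x i
  proof -
    show "torus_periodic e" using W(1) by (simp add: e_def torus_periodic_def)
    show "e differentiable (at x)" unfolding e_def
      using has_derivative_inner W(2) unfolding differentiable_def by blast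
    have "continuous_on UNIV (\<lambda>x. partial i e x)"
      unfolding pe by (intro continuous_intros cw W(3))
    then show "continuous_on UNIV (partial i e)" .
  qed
  have eq: "w x \<bullet> (advection u x - advection v x + gradient q x) =
      (1 / 2) * (u x \<bullet> gradient e x) + w x \<bullet> gradient q x
      + w x \<bullet> (\<Sum>i\<in>UNIV. (w x $ i) *\<^sub>R partial i v x)" for x
  proof -
    have "advection u x - advection v x =
      (\<Sum>i\<in>UNIV. (u x $ i) *\<^sub>R partial i w x) + (\<Sum>i\<in>UNIV. (w x $ i) *\<^sub>R partial i v x)"
      unfolding advection_def pw
      by (simp add: w_def algebra_simps sum.distrib sum_subtractf)
    moreover have "w x \<bullet> (\<Sum>i\<in>UNIV. (u x $ i) *\<^sub>R partial i w x) = (1 / 2) * (u x \<bullet> gradient e x)"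
      by (simp add: inner_sum_right gradient_def inner_vec_def[of "u x"] pe sum_distrib_left
          mult_ac)
    ultimately show ?thesis by (simp add: inner_add_right)
  qed
  have cgrad: "continuous_on UNIV (gradient f)" if "\<And>i. continuous_on UNIV (partial i f)" for f :: "real^'d \<Rightarrow> real"
    unfolding gradient_def by (intro continuous_on_vec_lambda that)
  have int: "f integrable_on torus_cell" if "continuous_on UNIV f" for f :: "real^'d \<Rightarrow> real"
    unfolding torus_cell_def by (intro integrable_continuous continuous_on_subset[OF that]) auto
  have "integral torus_cell (\<lambda>x. w x \<bullet> (advection u x - advection v x + gradient q x)) =
      (1 / 2) * integral torus_cell (\<lambda>x. u x \<bullet> gradient e x) + integral torus_cell (\<lambda>x. w x \<bullet> gradient q x)
      + integral torus_cell (\<lambda>x. w x \<bullet> (\<Sum>i\<in>UNIV. (w x $ i) *\<^sub>R partial i v x))"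
  proof -
    have i: "(\<lambda>x. (1 / 2) * (u x \<bullet> gradient e x)) integrable_on torus_cell"
      "(\<lambda>x. w x \<bullet> gradient q x) integrable_on torus_cell"
      "(\<lambda>x. w x \<bullet> (\<Sum>i\<in>UNIV. (w x $ i) *\<^sub>R partial i v x)) integrable_on torus_cell"
      by (intro int continuous_intros cgrad q e cw cu V(3))+
    show ?thesis
      unfolding eq integral_add[OF integrable_add[OF i(1,2)] i(3)] integral_add[OF i(1,2)]
      by simp
  qed
  then show ?thesis
    using integral_divergence_free_gradient[OF U(1) U(2) U(3) u(2) e]
      integral_divergence_free_gradient[OF W(1) W(2) W(3) divw q] by simp
qed

lemma inner_stretching_le:
  fixes a :: "real^'d" and g :: "'d \<Rightarrow> real^'d"
  assumes "\<And>i. norm (g i) \<le> M"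
  shows "\<bar>a \<bullet> (\<Sum>i\<in>UNIV. (a $ i) *\<^sub>R g i)\<bar> \<le> (real CARD('d) * M) * (a \<bullet> a)"
proof -
  have "norm (\<Sum>i\<in>UNIV. (a $ i) *\<^sub>R g i) \<le> (\<Sum>i\<in>(UNIV :: 'd set). norm a * M)"
    by (rule sum_norm_le) (simp add: mult_mono component_le_norm_cart assms)
  then have "\<bar>a \<bullet> (\<Sum>i\<in>UNIV. (a $ i) *\<^sub>R g i)\<bar> \<le> norm a * (real CARD('d) * (norm a * M))"
    by (intro order.trans[OF Cauchy_Schwarz_ineq2] mult_left_mono) auto
  then show ?thesis by (simp add: dot_square_norm power2_eq_square mult_ac)
qed

text \<open>The energy of the difference is differentiated under the integral sign, which is
  where the joint continuity of the time derivative, hence of the pressure gradient, enters. The bound on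
  the gradient is taken for \<open>v\<close> alone, uniformly in time by compactness.\<close>

theorem euler_solution_unique:
  fixes u v :: "real \<Rightarrow> real^'d \<Rightarrow> real^'d"
  assumes "euler_solution \<sigma> T u0 u" and "euler_solution \<sigma> T u0 v" and t: "t \<in> {0..T}"
  shows "u t = v t"
proof -
  let ?I = "{0..T}"
  from assms(1) obtain p where u: "continuous_curve \<sigma> T u" "\<And>t x. t \<in> ?I \<Longrightarrow> divergence (u t) x = 0" "u 0 = u0"
    and p: "\<And>t. t \<in> ?I \<Longrightarrow> torus_periodic (p t)" "\<And>t x. t \<in> ?I \<Longrightarrow> p t differentiable (at x)"
      "continuous_on (?I \<times> UNIV) (\<lambda>(t, x). gradient (p t) x)"
    and du: "\<And>t x. t \<in> ?I \<Longrightarrow> ((\<lambda>s. u s x) has_vector_derivative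
           (- advection (u t) x - gradient (p t) x)) (at t within ?I)"
    unfolding euler_solution_def by blast
  from assms(2) obtain q where v: "continuous_curve \<sigma> T v" "\<And>t x. t \<in> ?I \<Longrightarrow> divergence (v t) x = 0" "v 0 = u0"
    and q: "\<And>t. t \<in> ?I \<Longrightarrow> torus_periodic (q t)" "\<And>t x. t \<in> ?I \<Longrightarrow> q t differentiable (at x)"
      "continuous_on (?I \<times> UNIV) (\<lambda>(t, x). gradient (q t) x)"
    and dv: "\<And>t x. t \<in> ?I \<Longrightarrow> ((\<lambda>s. v s x) has_vector_derivative
           (- advection (v t) x - gradient (q t) x)) (at t within ?I)"
    unfolding euler_solution_def by blast
  note Cu = continuous_curve_C1_holder[OF u(1)] and Cv = continuous_curve_C1_holder[OF v(1)]
  note Ju = continuous_curve_jointly_continuous[OF u(1)]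
    and Jv = continuous_curve_jointly_continuous[OF v(1)]
  define w where "w = (\<lambda>t x. u t x - v t x)"
  define r where "r = (\<lambda>t x. p t x - q t x)"
  \<comment> \<open>The time derivative of \<open>w\<close>, with both pressures combined into \<open>r\<close>.\<close>
  define w' where "w' = (\<lambda>t x. - (advection (u t) x - advection (v t) x + gradient (r t) x))"
  have gr: "gradient (r t) x = gradient (p t) x - gradient (q t) x" if "t \<in> ?I" for t x
    unfolding r_def gradient_def vec_eq_iff
    by (simp add: partial_diff[OF p(2)[OF that] q(2)[OF that]])
  have dw: "((\<lambda>s. w s x) has_vector_derivative w' t x) (at t within ?I)" if "t \<in> ?I" for t x
    using has_vector_derivative_diff[OF du[OF that, of x] dv[OF that, of x]]
    by (simp add: w_def w'_def gr[OF that] algebra_simps)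
  have Jadv: "continuous_on (?I \<times> UNIV) (\<lambda>z. advection (y (fst z)) (snd z))"
    if "continuous_curve \<sigma> T y" for y :: "real \<Rightarrow> real^'d \<Rightarrow> real^'d"
    using continuous_curve_jointly_continuous[OF that]
    unfolding advection_def split_def by (intro continuous_intros) auto
  have Jw: "continuous_on (?I \<times> UNIV) (\<lambda>z. w (fst z) (snd z))"
    using Ju(1) Jv(1) unfolding w_def split_def by (intro continuous_intros)
  have Jw': "continuous_on (?I \<times> UNIV) (\<lambda>z. w' (fst z) (snd z))"
  proof -
    have "continuous_on (?I \<times> UNIV) (\<lambda>z. - (advection (u (fst z)) (snd z) - advection (v (fst z)) (snd z)
        + (gradient (p (fst z)) (snd z) - gradient (q (fst z)) (snd z))))"
      using p(3) q(3) unfolding split_def by (intro continuous_intros Jadv u v)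
    then show ?thesis unfolding w'_def by (rule continuous_on_eq) (auto simp: gr)
  qed
  have slice: "continuous_on S (f t)"
    if "continuous_on (?I \<times> UNIV) (\<lambda>z. f (fst z) (snd z))" "t \<in> ?I"
    for f :: "real \<Rightarrow> real^'d \<Rightarrow> 'z::topological_space" and t S
  proof -
    have "continuous_on S (\<lambda>x. (t, x))" by (rule continuous_on_Pair[OF continuous_on_const continuous_on_id])
    moreover have "(\<lambda>x. (t, x)) ` S \<subseteq> ?I \<times> UNIV" using that(2) by auto
    ultimately show ?thesis using continuous_on_compose2[OF that(1), of S "\<lambda>x. (t, x)"] by simp
  qed
  define E where "E = (\<lambda>t. integral torus_cell (\<lambda>x. w t x \<bullet> w t x))"
  have dE: "(E has_real_derivative integral torus_cell (\<lambda>x. 2 * (w t x \<bullet> w' t x))) (at t within ?I)"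
    if t: "t \<in> ?I" for t
    unfolding E_def torus_cell_def
  proof (rule leibniz_rule_field_derivative[where fx = "\<lambda>t x. 2 * (w t x \<bullet> w' t x)"])
    fix s x assume "s \<in> ?I"
    from bounded_bilinear.has_vector_derivative[OF bounded_bilinear_inner dw[OF this] dw[OF this], of x x]
    show "((\<lambda>s. w s x \<bullet> w s x) has_real_derivative 2 * (w s x \<bullet> w' s x)) (at s within ?I)"
      by (simp add: has_real_derivative_iff_has_vector_derivative inner_commute)
  next
    fix s assume "s \<in> ?I"
    then show "(\<lambda>x. w s x \<bullet> w s x) integrable_on cbox 0 (\<chi> i. 2 * pi)"
      by (intro integrable_continuous continuous_intros slice Jw)
  next
    have "continuous_on (?I \<times> UNIV) (\<lambda>(t, x). 2 * (w t x \<bullet> w' t x))"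
      unfolding split_def by (intro continuous_intros Jw Jw')
    then show "continuous_on (?I \<times> cbox 0 (\<chi> i. 2 * pi)) (\<lambda>(t, x). 2 * (w t x \<bullet> w' t x))"
      by (rule continuous_on_subset) auto
  qed (use t in auto)
  obtain M where M: "\<And>t x i. t \<in> ?I \<Longrightarrow> x \<in> torus_cell \<Longrightarrow> norm (partial i (v t) x) \<le> M"
  proof -
    \<comment> \<open>One bound per direction, from compactness of \<open>[0,T]\<close> times the cell.\<close>
    have "\<exists>M. \<forall>z\<in>?I \<times> torus_cell. norm (partial i (v (fst z)) (snd z)) \<le> M" for i
    proof -
      have "compact ((\<lambda>(t, x). partial i (v t) x) ` (?I \<times> torus_cell))"
        unfolding torus_cell_def
        by (intro compact_continuous_image continuous_on_subset[OF Jv(2)] compact_Times) auto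
      then obtain M where "\<forall>y\<in>(\<lambda>(t, x). partial i (v t) x) ` (?I \<times> torus_cell). norm y \<le> M"
        using compact_imp_bounded bounded_iff by metis
      then show ?thesis by (intro exI[of _ M]) (simp add: split_def)
    qed
    then obtain M where M: "\<And>i z. z \<in> ?I \<times> torus_cell \<Longrightarrow> norm (partial i (v (fst z)) (snd z)) \<le> M i"
      by metis
    have "norm (partial i (v t) x) \<le> Max (range M)" if "t \<in> ?I" "x \<in> torus_cell" for i t x
      using M[of "(t, x)" i] that by (auto intro: order.trans[OF _ Max_ge])
    then show ?thesis using that by blast
  qed
  define K where "K = 2 * (real CARD('d) * M)"
  have E': "integral torus_cell (\<lambda>x. 2 * (w t x \<bullet> w' t x)) \<le> K * E t" if t: "t \<in> ?I" for t
  proof -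
    let ?s = "\<lambda>x. w t x \<bullet> (\<Sum>i\<in>UNIV. (w t x $ i) *\<^sub>R partial i (v t) x)"
    have r: "torus_periodic (r t)" "r t differentiable (at x)" "continuous_on UNIV (partial i (r t))" for x i
    proof -
      show "torus_periodic (r t)" using p(1)[OF t] q(1)[OF t] by (simp add: r_def torus_periodic_def)
      show "r t differentiable (at x)" unfolding r_def by (intro differentiable_diff p q t)
      have "continuous_on UNIV (\<lambda>x. (gradient (p t) x - gradient (q t) x) $ i)"
        using p(3) q(3) unfolding split_def by (intro continuous_intros slice t)
      then show "continuous_on UNIV (partial i (r t))"
        by (rule continuous_on_eq) (simp only: gr[OF t, symmetric], simp add: gradient_def)
    qed
    have cs: "continuous_on torus_cell ?s"
      by (intro continuous_intros slice[OF Jw t] continuous_on_subset[OF C1_holderD(3)[OF Cv[OF t]]]) auto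
    have cw: "continuous_on torus_cell (w t)" by (rule slice[OF Jw t])
    have "integral torus_cell (\<lambda>x. 2 * (w t x \<bullet> w' t x)) =
        - 2 * integral torus_cell (\<lambda>x. w t x \<bullet> (advection (u t) x - advection (v t) x + gradient (r t) x))"
      unfolding w'_def inner_minus_right integral_mult_right[symmetric] by simp
    also have "\<dots> = - 2 * integral torus_cell ?s"
      using energy_identity[OF Cu[OF t] u(2)[OF t] Cv[OF t] v(2)[OF t] r]
      by (simp add: w_def)
    also have "\<dots> = integral torus_cell (\<lambda>x. - 2 * ?s x)" by simp
    also have "\<dots> \<le> integral torus_cell (\<lambda>x. K * (w t x \<bullet> w t x))"
    proof (rule integral_le)
      show "(\<lambda>x. - 2 * ?s x) integrable_on torus_cell" "(\<lambda>x. K * (w t x \<bullet> w t x)) integrable_on torus_cell"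
        unfolding torus_cell_def
        by (rule integrable_continuous, rule continuous_on_mult_left, rule cs[unfolded torus_cell_def])
           (rule integrable_continuous, rule continuous_on_mult_left,
            intro continuous_intros cw[unfolded torus_cell_def])
      fix x :: "real^'d" assume "x \<in> torus_cell"
      have "- 2 * ?s x \<le> 2 * \<bar>?s x\<bar>" by linarith
      also have "\<dots> \<le> 2 * ((real CARD('d) * M) * (w t x \<bullet> w t x))"
        by (intro mult_left_mono inner_stretching_le M t \<open>x \<in> torus_cell\<close>) simp
      also have "\<dots> = K * (w t x \<bullet> w t x)" by (simp only: K_def mult.assoc)
      finally show "- 2 * ?s x \<le> K * (w t x \<bullet> w t x)" .
    qed
    also have "\<dots> = K * E t" by (simp add: E_def)
    finally show ?thesis .
  qed
  have "E 0 = 0" by (simp add: E_def w_def u(3) v(3))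
  moreover have "E t \<ge> 0"
    unfolding E_def torus_cell_def
    by (intro integral_nonneg integrable_continuous continuous_intros slice[OF Jw t]) simp
  ultimately have "E t = 0" using gronwall_zero[OF dE E' _ _ t] by blast
  then have "integral (cbox 0 (\<chi> i. 2 * pi)) (\<lambda>x. w t x \<bullet> w t x) = 0"
    by (simp add: E_def torus_cell_def)
  moreover have "box 0 ((\<chi> i. 2 * pi) :: real^'d) \<noteq> {}"
  proof -
    have "(\<chi> i. pi) \<in> box 0 ((\<chi> i. 2 * pi) :: real^'d)" by (simp add: mem_box_cart)
    then show ?thesis by blast
  qed
  moreover have "continuous_on (cbox 0 (\<chi> i. 2 * pi)) (\<lambda>x. w t x \<bullet> w t x)"
    by (intro continuous_intros slice Jw t)
  ultimately have 0: "\<forall>x\<in>torus_cell. w t x = 0"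
    using integral_cbox_eq_0_iff[of 0 "\<chi> i. 2 * pi" "\<lambda>x. w t x \<bullet> w t x"] by (simp add: torus_cell_def)
  have "w t x = 0" for x
  proof -
    have "torus_periodic (w t)"
      using C1_holderD(1)[OF C1_holder_diff[OF Cu[OF t] Cv[OF t]]] by (simp add: w_def)
    then show ?thesis using periodic_represented_in_cell[of "w t" x] 0 by metis
  qed
  then show ?thesis by (auto simp: w_def)
qed

text \<open>The equation involves the values at times in \<open>{0..T}\<close> only, so changing the others yields the
  representative that the definite description selects.\<close>

lemma euler_solution_restrict:
  assumes u: "euler_solution \<sigma> T u0 u" and T: "0 \<le> T"
  shows "euler_solution \<sigma> T u0 (restrict u {0..T})"
proof -
  let ?I = "{0..T}" and ?r = "restrict u {0..T}"
  have "continuous_curve \<sigma> T ?r"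
    unfolding continuous_curve_def
  proof (intro ballI conjI)
    fix t assume t: "t \<in> ?I"
    then show "?r t \<in> little_holder \<sigma>" using u by (simp add: euler_solution_def continuous_curve_def)
    have "((\<lambda>s. C1_holder_norm \<sigma> (\<lambda>x. u s x - u t x)) \<longlongrightarrow> 0) (at t within ?I)"
      using u t by (simp add: euler_solution_def continuous_curve_def)
    then show "((\<lambda>s. C1_holder_norm \<sigma> (\<lambda>x. ?r s x - ?r t x)) \<longlongrightarrow> 0) (at t within ?I)"
      by (rule Lim_transform_eventually) (use t in \<open>auto simp: eventually_at_filter\<close>)
  qed
  moreover have "((\<lambda>s. ?r s x) has_vector_derivative D) (at t within ?I)"
    if "((\<lambda>s. u s x) has_vector_derivative D) (at t within ?I)" "t \<in> ?I" for x D t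
    by (rule has_vector_derivative_transform[OF that(2) _ that(1)]) simp
  ultimately show ?thesis
    using u T unfolding euler_solution_def by auto
qed

lemma data_to_solution_eq:
  assumes u: "euler_solution \<sigma> T u0 u" and t: "t \<in> {0..T}"
  shows "data_to_solution \<sigma> T u0 t = u t"
proof -
  have T: "0 \<le> T" using t by simp
  have "data_to_solution \<sigma> T u0 = restrict u {0..T}"
    unfolding data_to_solution_def
  proof (rule the_equality)
    show "restrict u {0..T} \<in> extensional {0..T} \<and> euler_solution \<sigma> T u0 (restrict u {0..T})"
      using euler_solution_restrict[OF u T] by simp
    fix v assume v: "v \<in> extensional {0..T} \<and> euler_solution \<sigma> T u0 v"
    then show "v = restrict u {0..T}"
      using euler_solution_unique[of \<sigma> T u0 v u] u by (auto simp: extensional_def restrict_def fun_eq_iff)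
  qed
  then show ?thesis using t by simp
qed

section \<open>Plane waves\<close>

text \<open>The phase \<open>\<theta>\<close> and the constant \<open>B\<close> are kept as parameters because the family is then closed
  under partial derivatives (a shift of phase by a quarter period) and under differences
  of two waves of equal amplitude (sum-to-product formula). Every norm below reduces to that of a single wave.\<close>

definition plane_wave :: "'d \<Rightarrow> nat \<Rightarrow> real \<Rightarrow> 'b::real_normed_vector \<Rightarrow> 'b \<Rightarrow> real^'d \<Rightarrow> 'b" where
  "plane_wave j n \<theta> A B x = cos (real n * x $ j - \<theta>) *\<^sub>R A + B"

lemma plane_wave_has_derivative:
  "(plane_wave j n \<theta> A B has_derivative
     (\<lambda>h. (h $ j) *\<^sub>R cos (real n * x $ j - (\<theta> - pi / 2)) *\<^sub>R real n *\<^sub>R A)) (at x)"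
proof -
  have 1: "((\<lambda>x. x $ j) has_derivative (\<lambda>h. h $ j)) (at x)"
    by (rule bounded_linear.has_derivative[OF bounded_linear_vec_nth has_derivative_ident])
  have 2: "cos (real n * x $ j - (\<theta> - pi / 2)) = - sin (real n * x $ j - \<theta>)"
    using minus_sin_cos_eq[of "real n * x $ j - \<theta>"] by (simp add: algebra_simps)
  show ?thesis unfolding plane_wave_def[abs_def] 2
    by (rule derivative_eq_intros 1 refl)+ (simp add: algebra_simps)
qed

lemma plane_wave_differentiable: "plane_wave j n \<theta> A B differentiable (at x)"
  using plane_wave_has_derivative differentiableI by blast

lemma partial_plane_wave:
  "partial i (plane_wave j n \<theta> A B) =
     plane_wave j n (\<theta> - pi / 2) (if i = j then real n *\<^sub>R A else 0) 0"
  by (rule ext, subst partial_eqI[OF plane_wave_has_derivative])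
     (auto simp: plane_wave_def axis_def)

lemma plane_wave_periodic: "torus_periodic (plane_wave j n \<theta> A B)"
proof -
  have "cos (real n * (x $ j + 2 * pi) - \<theta>) = cos (real n * x $ j - \<theta>)" for x :: "real^'a"
    using cos.plus_of_nat[of "real n * x $ j - \<theta>" n] by (simp add: algebra_simps)
  then show ?thesis
    by (auto simp: torus_periodic_def plane_wave_def axis_def)
qed

lemma plane_wave_smooth: "plane_wave j n \<theta> A B \<in> torus_smooth"
proof -
  have "C_k k (plane_wave j n \<theta> A B)" for k
  proof (induction k arbitrary: \<theta> A B)
    case 0
    show ?case
      by (simp add: continuous_on_if_differentiable plane_wave_differentiable)
  next
    case (Suc k)
    then show ?case by (simp add: partial_plane_wave plane_wave_differentiable)
  qed
  then show ?thesis by (simp add: torus_smooth_def plane_wave_periodic)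
qed

text \<open>Interpolation of a bounded quantity with a linear bound, the two cases being \<open>s \<le> 1\<close> and \<open>s > 1\<close>.\<close>

lemma min_le_powr:
  fixes s \<sigma> :: real
  assumes "0 < \<sigma>" "\<sigma> < 1" "0 \<le> s" "y \<le> 2" "y \<le> s"
  shows "y \<le> 2 * s powr \<sigma>"
proof (cases "s \<le> 1")
  case True
  have "s \<le> s powr \<sigma>"
  proof (cases "s = 0")
    case False
    with powr_mono'[of \<sigma> 1 s] assms True show ?thesis by simp
  qed simp
  then show ?thesis using assms by simp
next
  case False
  then have "1 \<le> s powr \<sigma>" using assms by (simp add: ge_one_powr_ge_zero)
  then show ?thesis using assms by simp
qed

text \<open>A wave with unit amplitude has oscillation at most \<open>2\<close> and Lipschitz constant at most \<open>n\<close>; interpolating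
  between the two bounds gives the factor \<open>n\<^sup>\<sigma>\<close>.\<close>

lemma plane_wave_holder:
  fixes A :: "'b::real_normed_vector"
  assumes "0 < \<sigma>" "\<sigma> < 1"
  shows "dist (plane_wave j n \<theta> A B x) (plane_wave j n \<theta> A B y)
    \<le> (2 * real n powr \<sigma> * norm A) * dist x y powr \<sigma>"
proof -
  let ?c = "\<lambda>x. cos (real n * x $ j - \<theta>)"
  have "\<bar>?c x - ?c y\<bar> \<le> 2"
    using abs_cos_le_one[of "real n * x $ j - \<theta>"] abs_cos_le_one[of "real n * y $ j - \<theta>"] by linarith
  moreover have "\<bar>?c x - ?c y\<bar> \<le> real n * dist x y"
  proof -
    have "\<bar>?c x - ?c y\<bar> \<le> \<bar>(real n * x $ j - \<theta>) - (real n * y $ j - \<theta>)\<bar>"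
    proof -
      have "\<bar>cos a - cos b\<bar> \<le> \<bar>a - b\<bar>" for a b :: real
      proof -
        have "norm (cos a - cos b) \<le> 1 * norm (a - b)"
          by (rule field_differentiable_bound[of UNIV cos "\<lambda>x. - sin x"])
             (auto intro!: derivative_eq_intros)
        then show ?thesis by simp
      qed
      then show ?thesis .
    qed
    also have "\<dots> = real n * \<bar>(x - y) $ j\<bar>" by (simp add: abs_mult flip: right_diff_distrib)
    also have "\<dots> \<le> real n * dist x y"
      by (intro mult_left_mono) (auto simp: dist_norm simp del: vector_minus_component intro: component_le_norm_cart)
    finally show ?thesis .
  qed
  ultimately have "\<bar>?c x - ?c y\<bar> \<le> 2 * (real n * dist x y) powr \<sigma>"
    by (intro min_le_powr assms) auto
  then have "\<bar>?c x - ?c y\<bar> * norm A \<le> 2 * (real n powr \<sigma> * dist x y powr \<sigma>) * norm A"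
    by (intro mult_right_mono) (auto simp: powr_mult)
  moreover have "dist (plane_wave j n \<theta> A B x) (plane_wave j n \<theta> A B y) = \<bar>?c x - ?c y\<bar> * norm A"
    by (simp add: plane_wave_def dist_norm flip: scaleR_diff_left)
  ultimately show ?thesis by (simp add: mult_ac)
qed

lemma plane_wave_C1_holder:
  assumes "0 < \<sigma>" "\<sigma> < 1"
  shows "plane_wave j n \<theta> A B \<in> C1_holder \<sigma>"
proof -
  have "C_k 1 (plane_wave j n \<theta> A B)" using plane_wave_smooth unfolding torus_smooth_def by blast
  moreover have "holder_continuous \<sigma> (partial i (plane_wave j n \<theta> A B))" for i
    unfolding partial_plane_wave holder_continuous_def using plane_wave_holder[OF assms] by blast
  ultimately show ?thesis by (simp add: C1_holder_def plane_wave_periodic)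
qed

lemma C1_holder_norm_plane_wave_le:
  fixes A B :: "'b::real_normed_vector" and j :: "'d::finite"
  assumes \<sigma>: "0 < \<sigma>" "\<sigma> < 1" and n: "n \<ge> 1"
  shows "C1_holder_norm \<sigma> (plane_wave j n \<theta> A B) \<le> 4 * real n powr (1 + \<sigma>) * norm A + norm B"
proof -
  let ?f = "plane_wave j n \<theta> A B"
  let ?A = "\<lambda>i. if i = j then real n *\<^sub>R A else 0"
  have sup: "norm (plane_wave j n \<theta> A B x) \<le> norm A + norm B" for \<theta> x and A B :: 'b
    unfolding plane_wave_def
    by (rule order.trans[OF norm_triangle_ineq]) (simp add: mult_left_le_one_le)
  have "C1_holder_norm \<sigma> ?f \<le> (norm A + norm B)
      + (\<Sum>i\<in>UNIV. if i = j then real n * norm A else 0)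
      + (\<Sum>i\<in>UNIV. if i = j then 2 * real n powr \<sigma> * (real n * norm A) else 0)"
  proof (rule C1_holder_norm_le)
    show "norm (?f x) \<le> norm A + norm B" for x by (rule sup)
    show "norm (partial i ?f x) \<le> (if i = j then real n * norm A else 0)" for i x
      using sup[of "\<theta> - pi / 2" "?A i" 0 x] by (auto simp: partial_plane_wave)
    show "dist (partial i ?f x) (partial i ?f y)
        \<le> (if i = j then 2 * real n powr \<sigma> * (real n * norm A) else 0) * dist x y powr \<sigma>" for i x y
      using plane_wave_holder[OF \<sigma>, of j n "\<theta> - pi / 2" "?A i" 0 x y]
      by (auto simp: partial_plane_wave)
  qed
  also have "\<dots> = (1 + real n + 2 * real n powr (1 + \<sigma>)) * norm A + norm B"
    using n by (simp add: powr_add algebra_simps)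
  also have "\<dots> \<le> (4 * real n powr (1 + \<sigma>)) * norm A + norm B"
  proof -
    have "real n powr 1 \<le> real n powr (1 + \<sigma>)" using n \<sigma> by (intro powr_mono) auto
    then show ?thesis using n by (intro add_right_mono mult_right_mono) auto
  qed
  finally show ?thesis by simp
qed

lemma plane_wave_little_holder:
  fixes A B :: "'b::real_normed_vector" and j :: "'d::finite"
  assumes \<sigma>: "0 < \<sigma>" "\<sigma> < 1"
  shows "plane_wave j n \<theta> A B \<in> little_holder \<sigma>"
proof -
  have "(\<lambda>x. plane_wave j n \<theta> A B x - plane_wave j n \<theta> A B x) = plane_wave j 1 0 0 0"
    by (simp add: plane_wave_def fun_eq_iff)
  then have "C1_holder_norm \<sigma> (\<lambda>x. plane_wave j n \<theta> A B x - plane_wave j n \<theta> A B x) \<le> 0"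
    using C1_holder_norm_plane_wave_le[OF \<sigma>, of 1 j 0 "0 :: 'b" 0] by simp
  then show ?thesis
    unfolding little_holder_def
    using plane_wave_C1_holder[OF \<sigma>] plane_wave_smooth by (blast intro: order.strict_trans1)
qed

lemma plane_wave_diff:
  "(\<lambda>x. plane_wave j n \<theta> A B x - plane_wave j n \<theta>' A B' x) =
     plane_wave j n ((\<theta> + \<theta>') / 2 + pi / 2) ((2 * sin ((\<theta> - \<theta>') / 2)) *\<^sub>R A) (B - B')"
proof
  fix x :: "real^'a"
  let ?y = "real n * x $ j"
  have "cos (?y - \<theta>) - cos (?y - \<theta>') = 2 * sin ((\<theta> - \<theta>') / 2) * sin (?y - (\<theta> + \<theta>') / 2)"
    by (simp add: cos_diff_cos field_simps)
  also have "sin (?y - (\<theta> + \<theta>') / 2) = cos (?y - ((\<theta> + \<theta>') / 2 + pi / 2))"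
    using sin_cos_eq[of "?y - (\<theta> + \<theta>') / 2"] cos_minus[of "?y - ((\<theta> + \<theta>') / 2 + pi / 2)"]
    by (simp add: algebra_simps)
  finally have "(cos (?y - \<theta>) - cos (?y - \<theta>')) *\<^sub>R A
      = (2 * sin ((\<theta> - \<theta>') / 2) * cos (?y - ((\<theta> + \<theta>') / 2 + pi / 2))) *\<^sub>R A" by simp
  then show "plane_wave j n \<theta> A B x - plane_wave j n \<theta>' A B' x =
     plane_wave j n ((\<theta> + \<theta>') / 2 + pi / 2) ((2 * sin ((\<theta> - \<theta>') / 2)) *\<^sub>R A) (B - B') x"
    by (simp add: plane_wave_def algebra_simps)
qed

text \<open>The derivative takes its extreme values \<open>\<plusminus> n A\<close> at two points half a wavelength \<open>\<pi> / n\<close>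
  apart, and that pair already produces a Hoelder quotient of order \<open>n\<^sup>1\<^sup>+\<^sup>\<sigma>\<close>.\<close>

lemma C1_holder_norm_plane_wave_ge:
  fixes A B :: "'b::real_normed_vector" and j :: "'d::finite"
  assumes \<sigma>: "0 < \<sigma>" "\<sigma> < 1" and n: "n \<ge> 1"
  shows "2 * real n powr (1 + \<sigma>) * norm A / pi powr \<sigma> \<le> C1_holder_norm \<sigma> (plane_wave j n \<theta> A B)"
proof -
  let ?g = "partial j (plane_wave j n \<theta> A B)"
  \<comment> \<open>The phase of the derivative is \<open>\<theta> - \<pi> / 2\<close>, so it has a crest at \<open>x\<close> and a trough at \<open>y\<close>.\<close>
  define x where "x = axis j ((\<theta> - pi / 2) / real n)"
  define y where "y = axis j ((\<theta> + pi / 2) / real n)"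
  have g: "?g x = real n *\<^sub>R A" "?g y = - (real n *\<^sub>R A)"
    using n by (auto simp: partial_plane_wave plane_wave_def x_def y_def axis_def)
  have "x - y = axis j (- (pi / real n))"
    using n by (auto simp: x_def y_def axis_def vec_eq_iff diff_divide_distrib add_divide_distrib)
  then have d: "dist x y = pi / real n" by (simp add: dist_norm norm_eq_sqrt_inner inner_axis_axis real_sqrt_divide)
  then have "x \<noteq> y" using n by auto
  have "dist (?g x) (?g y) = 2 * (real n * norm A)"
    unfolding g dist_norm by (simp flip: scaleR_2)
  then have "2 * real n powr (1 + \<sigma>) * norm A / pi powr \<sigma> = dist (?g x) (?g y) / dist x y powr \<sigma>"
    using n by (simp add: d powr_divide powr_add)
  also have "\<dots> \<le> holder_seminorm \<sigma> ?g"
    by (intro holder_quotient_le_seminorm C1_holderD(4) plane_wave_C1_holder \<sigma> \<open>x \<noteq> y\<close>)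
  also have "\<dots> \<le> C1_holder_norm \<sigma> (plane_wave j n \<theta> A B)"
    by (intro holder_seminorm_le_C1_holder_norm plane_wave_C1_holder \<sigma>)
  finally show ?thesis .
qed

section \<open>Drifting shear flows\<close>

text \<open>The Galilean boost, with velocity \<open>c\<close> in direction \<open>j\<close>, of the steady shear flow
  \<open>a cos(n x\<^sub>j) e\<^sub>i\<close>. Drift \<open>c\<close> turns into the phase \<open>n c t\<close>.\<close>

definition drifting_shear :: "'d \<Rightarrow> 'd \<Rightarrow> nat \<Rightarrow> real \<Rightarrow> real \<Rightarrow> real \<Rightarrow> real^'d \<Rightarrow> real^'d" where
  "drifting_shear i j n a c t = plane_wave j n (real n * c * t) (axis i a) (axis j c)"

lemma drifting_shear_continuous_curve:
  assumes \<sigma>: "0 < \<sigma>" "\<sigma> < 1" and n: "n \<ge> 1"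
  shows "continuous_curve \<sigma> T (drifting_shear i j n a c)"
  unfolding continuous_curve_def
proof (intro ballI conjI)
  fix t assume "t \<in> {0..T}"
  let ?u = "drifting_shear i j n a c"
  show "?u t \<in> little_holder \<sigma>" unfolding drifting_shear_def by (rule plane_wave_little_holder[OF \<sigma>])
  let ?A = "\<lambda>s. (2 * sin ((real n * c * s - real n * c * t) / 2)) *\<^sub>R axis i a"
  let ?N = "\<lambda>s. C1_holder_norm \<sigma> (\<lambda>x. ?u s x - ?u t x)"
  have up: "?N s \<le> 4 * real n powr (1 + \<sigma>) * norm (?A s)" for s
    unfolding drifting_shear_def plane_wave_diff
    using C1_holder_norm_plane_wave_le[OF \<sigma> n, where A = "?A s" and B = 0] by simp
  have lo: "0 \<le> ?N s" for s
    unfolding drifting_shear_def plane_wave_diff by (rule C1_holder_norm_nonneg[OF plane_wave_C1_holder[OF \<sigma>]])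
  have "((\<lambda>s. 4 * real n powr (1 + \<sigma>) * norm (?A s)) \<longlongrightarrow> 4 * real n powr (1 + \<sigma>) * norm (?A t))
      (at t within {0..T})"
    by (intro tendsto_intros) auto
  then have "((\<lambda>s. 4 * real n powr (1 + \<sigma>) * norm (?A s)) \<longlongrightarrow> 0) (at t within {0..T})"
    by simp
  from tendsto_sandwich[OF _ _ tendsto_const this]
  show "(?N \<longlongrightarrow> 0) (at t within {0..T})" using up lo by simp
qed

lemma drifting_shear_divergence:
  assumes "i \<noteq> j"
  shows "divergence (drifting_shear i j n a c t) x = 0"
  unfolding divergence_def drifting_shear_def partial_plane_wave
  using assms by (auto simp: plane_wave_def axis_def intro!: sum.neutral)

text \<open>Only the component \<open>u\<^sub>j = c\<close> meets a nonzero derivative, so the advection term is linear and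
  reduces to \<open>c \<partial>\<^sub>j u\<close>. The transport of the profile balances it with zero pressure.\<close>

lemma drifting_shear_euler_solution:
  fixes i j :: "'d::finite"
  assumes \<sigma>: "0 < \<sigma>" "\<sigma> < 1" and n: "n \<ge> 1" and ij: "i \<noteq> j"
  shows "euler_solution \<sigma> T (drifting_shear i j n a c 0) (drifting_shear i j n a c)"
proof -
  let ?u = "drifting_shear i j n a c"
  have grad: "gradient (\<lambda>x. 0) x = 0" for x :: "real^'d"
    unfolding gradient_def vec_eq_iff using partial_eqI[OF has_derivative_const] by auto
  have adv: "advection (?u t) x = (c * (real n * cos (real n * x $ j - (real n * c * t - pi / 2)))) *\<^sub>R axis i a"
    for t x
  proof -
    have "advection (?u t) x = (\<Sum>k\<in>UNIV. if k = j then
        (c * (real n * cos (real n * x $ j - (real n * c * t - pi / 2)))) *\<^sub>R axis i a else 0)"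
      unfolding advection_def drifting_shear_def partial_plane_wave
      using ij by (intro sum.cong refl) (auto simp: plane_wave_def axis_def)
    then show ?thesis by simp
  qed
  have "((\<lambda>s. ?u s x) has_vector_derivative - advection (?u t) x - gradient (\<lambda>x. 0) x) (at t within S)" for t x S
  proof -
    have "cos (real n * x $ j - (real n * c * t - pi / 2)) = - sin (real n * x $ j - real n * c * t)"
      using minus_sin_cos_eq[of "real n * x $ j - real n * c * t"] by (simp add: algebra_simps)
    then show ?thesis
      unfolding adv grad unfolding drifting_shear_def plane_wave_def
      by (auto intro!: derivative_eq_intros simp: algebra_simps)
  qed
  then show ?thesis
    unfolding euler_solution_def
    using drifting_shear_continuous_curve[OF \<sigma> n] drifting_shear_divergence[OF ij]
    by (intro conjI exI[of _ "\<lambda>t x. 0"]) (auto simp: torus_periodic_def grad split_def)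
qed

section \<open>Nonuniform dependence on the initial data\<close>

theorem corollary1:
  fixes \<sigma> T :: real
  assumes "0 < \<sigma>" and "\<sigma> < 1"
    and "CARD('d::finite) = 2 \<or> CARD('d) = 3"
    and "T > 0"
  shows "\<exists>\<epsilon>>0. \<forall>\<eta>>0. \<exists>u0 \<in> euler_domain \<sigma> T. \<exists>v0 \<in> (euler_domain \<sigma> T :: (real^'d \<Rightarrow> real^'d) set).
           C1_holder_norm \<sigma> u0 \<le> 1 \<and> C1_holder_norm \<sigma> v0 \<le> 1 \<and>
           C1_holder_norm \<sigma> (\<lambda>x. u0 x - v0 x) < \<eta> \<and>
           (SUP t\<in>{0..T}. C1_holder_norm \<sigma>
              (\<lambda>x. data_to_solution \<sigma> T u0 t x - data_to_solution \<sigma> T v0 t x)) \<ge> \<epsilon>"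
proof (intro exI[of _ "1 / (2 * pi powr \<sigma>)"] conjI allI impI)
  note \<sigma> = assms(1,2)
  show "1 / (2 * pi powr \<sigma>) > 0" by simp
  fix \<eta> :: real assume \<eta>: "\<eta> > 0"
  obtain i j :: 'd where ij: "i \<noteq> j"
  proof -
    have "\<not> card (UNIV :: 'd set) \<le> Suc 0" using assms(3) by auto
    then show ?thesis using that card_le_Suc0_iff_eq[of "UNIV :: 'd set"] by auto
  qed
  define \<mu> where "\<mu> = min \<eta> (1 / 2)"
  have \<mu>: "\<mu> > 0" "\<mu> \<le> \<eta>" "\<mu> \<le> 1 / 2" using \<eta> by (auto simp: \<mu>_def)
  \<comment> \<open>The frequency is taken so high that the drift \<open>\<pi> / (n T)\<close>, which moves the wave by half a
    wavelength in time \<open>T\<close>, is smaller than \<open>\<eta>\<close> and fits into the unit ball.\<close>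
  obtain n :: nat where n: "n > pi / (T * \<mu>)" using reals_Archimedean2 by blast
  moreover have "pi / (T * \<mu>) > 0" using \<mu>(1) assms(4) by simp
  ultimately have n0: "real n > 0" by linarith
  then have n1: "n \<ge> 1" by simp
  define c where "c = pi / (real n * T)"
  have "0 < c" using n0 assms(4) by (simp add: c_def)
  moreover have "c < \<mu>" using n n0 assms(4) \<mu>(1) by (simp add: c_def field_simps)
  ultimately have c: "0 < c" "c < \<eta>" "c < 1 / 2" using \<mu> by auto
  define a where "a = 1 / (8 * real n powr (1 + \<sigma>))"
  have a: "a > 0" "real n powr (1 + \<sigma>) * a = 1 / 8" using n0 by (auto simp: a_def)
  have norm_axis: "norm (axis k s :: real^'d) = \<bar>s\<bar>" for k s
    by (simp add: norm_eq_sqrt_inner inner_axis_axis)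
  \<comment> \<open>With this \<open>a\<close>, one bound covers the initial data (\<open>r = 1\<close>), their difference (\<open>r = 0\<close>) and
    the difference at later times (\<open>|r| \<le> 2\<close>).\<close>
  have nrm: "C1_holder_norm \<sigma> (plane_wave j n \<theta> (r *\<^sub>R axis i a) (axis j b :: real^'d)) \<le> \<bar>r\<bar> / 2 + \<bar>b\<bar>" for \<theta> r b
  proof -
    have "C1_holder_norm \<sigma> (plane_wave j n \<theta> (r *\<^sub>R axis i a) (axis j b :: real^'d))
        \<le> 4 * real n powr (1 + \<sigma>) * norm (r *\<^sub>R axis i a :: real^'d) + norm (axis j b :: real^'d)"
      by (rule C1_holder_norm_plane_wave_le[OF \<sigma> n1])
    also have "\<dots> = 4 * \<bar>r\<bar> * (real n powr (1 + \<sigma>) * a) + \<bar>b\<bar>"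
      using a(1) by (simp add: norm_axis)
    also have "\<dots> = \<bar>r\<bar> / 2 + \<bar>b\<bar>" unfolding a(2) by simp
    finally show ?thesis .
  qed
  let ?u = "drifting_shear i j n a 0" and ?v = "drifting_shear i j n a c"
  have sol: "euler_solution \<sigma> T (drifting_shear i j n a b 0) (drifting_shear i j n a b)" for b
    by (rule drifting_shear_euler_solution[OF \<sigma> n1 ij])
  have dom: "drifting_shear i j n a b 0 \<in> euler_domain \<sigma> T" for b
  proof -
    have "drifting_shear i j n a b 0 \<in> little_holder \<sigma>"
      unfolding drifting_shear_def by (rule plane_wave_little_holder[OF \<sigma>])
    then show ?thesis
      using sol[of b] drifting_shear_divergence[OF ij] unfolding euler_domain_def by blast
  qed
  have unit: "C1_holder_norm \<sigma> (drifting_shear i j n a b 0) \<le> 1" if "0 \<le> b" "b \<le> 1 / 2" for b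
    using nrm[of 0 1 b] that by (simp add: drifting_shear_def)
  have diff: "(\<lambda>x. ?u t x - ?v t x) = plane_wave j n (real n * c * t / 2 + pi / 2)
      ((- 2 * sin (real n * c * t / 2)) *\<^sub>R axis i a) (axis j (- c))" for t
  proof -
    have "axis j 0 - axis j c = (axis j (- c) :: real^'d)" by (simp add: vec_eq_iff axis_def)
    then show ?thesis unfolding drifting_shear_def plane_wave_diff by simp
  qed
  have "C1_holder_norm \<sigma> (\<lambda>x. ?u 0 x - ?v 0 x) < \<eta>"
    unfolding diff using nrm[of "pi / 2" 0 "- c"] c by simp
  moreover have "1 / (2 * pi powr \<sigma>) \<le> (SUP t\<in>{0..T}. C1_holder_norm \<sigma>
              (\<lambda>x. data_to_solution \<sigma> T (?u 0) t x - data_to_solution \<sigma> T (?v 0) t x))"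
  proof -
    have T: "real n * c * T / 2 = pi / 2" using n0 assms(4) by (simp add: c_def)
    have "1 / (2 * pi powr \<sigma>) = 4 * (real n powr (1 + \<sigma>) * a) / pi powr \<sigma>"
      unfolding a(2) by simp
    also have "\<dots> = 2 * real n powr (1 + \<sigma>) * norm ((- 2 * sin (real n * c * T / 2)) *\<^sub>R axis i a :: real^'d) / pi powr \<sigma>"
      unfolding T using a(1) by (simp add: norm_axis)
    also have "\<dots> \<le> C1_holder_norm \<sigma> (\<lambda>x. ?u T x - ?v T x)"
      unfolding diff by (rule C1_holder_norm_plane_wave_ge[OF \<sigma> n1])
    \<comment> \<open>The supremum dominates the value at \<open>T\<close> because the norms of the differences are bounded in \<open>t\<close>.\<close>
    also have "\<dots> \<le> (SUP t\<in>{0..T}. C1_holder_norm \<sigma> (\<lambda>x. ?u t x - ?v t x))"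
    proof (rule cSUP_upper)
      show "bdd_above ((\<lambda>t. C1_holder_norm \<sigma> (\<lambda>x. ?u t x - ?v t x)) ` {0..T})"
      proof (rule bdd_aboveI2)
        fix t
        have "C1_holder_norm \<sigma> (\<lambda>x. ?u t x - ?v t x) \<le> \<bar>- 2 * sin (real n * c * t / 2)\<bar> / 2 + \<bar>- c\<bar>"
          unfolding diff by (rule nrm)
        also have "\<dots> \<le> 1 + c" using c abs_sin_le_one[of "real n * c * t / 2"] by (simp add: abs_mult)
        finally show "C1_holder_norm \<sigma> (\<lambda>x. ?u t x - ?v t x) \<le> 1 + c" .
      qed
    qed (use assms(4) in simp)
    also have "\<dots> = (SUP t\<in>{0..T}. C1_holder_norm \<sigma>
              (\<lambda>x. data_to_solution \<sigma> T (?u 0) t x - data_to_solution \<sigma> T (?v 0) t x))"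
      by (intro SUP_cong refl) (simp add: data_to_solution_eq[OF sol])
    finally show ?thesis .
  qed
  ultimately show "\<exists>u0 \<in> euler_domain \<sigma> T. \<exists>v0 \<in> (euler_domain \<sigma> T :: (real^'d \<Rightarrow> real^'d) set).
           C1_holder_norm \<sigma> u0 \<le> 1 \<and> C1_holder_norm \<sigma> v0 \<le> 1 \<and>
           C1_holder_norm \<sigma> (\<lambda>x. u0 x - v0 x) < \<eta> \<and>
           (SUP t\<in>{0..T}. C1_holder_norm \<sigma>
              (\<lambda>x. data_to_solution \<sigma> T u0 t x - data_to_solution \<sigma> T v0 t x)) \<ge> 1 / (2 * pi powr \<sigma>)"
    using dom[of 0] dom[of c] unit[of 0] unit[of c] c by (intro bexI[of _ "?u 0"] bexI[of _ "?v 0"]) auto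
qed

end
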